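(* Let $\omega_{(1)}=(4,4,3)$, $\omega_{(2)}=(4,4,1,1)$, $\omega_{(3)}=(4,2,2,1)$, $\omega_{(4)}=(4,2,4)$ (weight vectors of degree $24$). There is a direct sum decomposition of $\mathbb F_2$-vector spaces $$(\mathbb F_2\otimes_{\mathcal A}P_5)_{24}=(QP_5^0)_{24}\oplus QP_5^+(\omega_{(1)})\oplus QP_5^+(\omega_{(2)})\oplus QP_5^+(\omega_{(3)})\oplus QP_5^+(\omega_{(4)}).$$
   Context: $P_k=\mathbb F_2[x_1,\dots,x_k]$ with $\deg x_j=1$, viewed as a module over the mod-2 Steenrod algebra $\mathcal A$; $\mathcal A^+$ is the augmentation ideal and $QP_k=\mathbb F_2\otimes_{\mathcal A}P_k=P_k/\mathcal A^+P_k$; subscripts denote homogeneous degree. $P_k^0$ is the span of monomials $x_1^{a_1}\cdots x_k^{a_k}$ with $a_1\cdots a_k=0$, $P_k^+$ the span of those with $a_1\cdots a_k>0$ (both $\mathcal A$-submodules), $QP_k^0=\mathbb F_2\otimes_{\mathcal A}P_k^0$, $QP_k^+=\mathbb F_2\otimes_{\mathcal A}P_k^+$. For a monomial $x$ with exponents $\nu_j(x)$, its weight vector is $\omega(x)=(\omega_1(x),\omega_2(x),\dots)$ with $\omega_i(x)=\sum_{j=1}^k\alpha_{i-1}(\nu_j(x))$, where $\alpha_t(a)$ is the $t$-th binary digit of $a$. For a weight vector $\omega$ (a sequence of nonnegative integers eventually zero), $\deg\omega=\sum_{i\ge1}2^{i-1}\omega_i$; weight vectors are ordered left-lexicographically.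 $P_k(\omega)$ is spanned by monomials $y$ with $\deg y=\deg\omega$ and $\omega(y)\le\omega$; $P_k^-(\omega)$ by those with $\omega(y)<\omega$. $QP_k(\omega)=P_k(\omega)/\big((\mathcal A^+P_k\cap P_k(\omega))+P_k^-(\omega)\big)$, and $QP_k^+(\omega)$ is the analogous quotient built from $P_k^+\cap P_k(\omega)$ (i.e. $QP_k(\omega)\cap QP_k^+$). *)

theory Defs
  imports Main
begin

text \<open>Concrete model of P_k = F_2[x_1,...,x_k].
  A monomial x_1^{a_1}...x_k^{a_k} is its exponent list [a_1,...,a_k] (length k).
  A polynomial over F_2 is the finite set of monomials with coefficient 1;
  addition is symmetric difference.\<close>

type_synonym mono = "nat list"
type_synonym poly = "mono set"

definition padd :: "poly \<Rightarrow> poly \<Rightarrow> poly" where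
  "padd p q = (p - q) \<union> (q - p)"

inductive_set f2span :: "poly set \<Rightarrow> poly set" for S :: "poly set" where
  zero: "{} \<in> f2span S"
| add: "p \<in> S \<Longrightarrow> q \<in> f2span S \<Longrightarrow> padd p q \<in> f2span S"

definition qdim :: "poly set \<Rightarrow> poly set \<Rightarrow> nat" where
  "qdim V U = (LEAST n. \<exists>B. finite B \<and> card B = n \<and> B \<subseteq> V \<and> f2span (B \<union> U) = V)"

definition monomsk :: "nat \<Rightarrow> nat \<Rightarrow> mono set" where
  "monomsk k d = {m. length m = k \<and> sum_list m = d}"

text \<open>Monomials spanning P_k^+ (all exponents positive); the others span P_k^0.\<close>
definition posmono :: "mono \<Rightarrow> bool" where
  "posmono m = (\<forall>j<length m. 0 < m ! j)"

text \<open>Steenrod square Sq^i on a monomial, via the Cartan formula and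
  Sq^t(x^a) = binom(a,t) x^(a+t): the coefficient of x^b in Sq^i(x^a) is
  the product of binom(a_j, b_j - a_j), taken mod 2.\<close>
definition sq :: "nat \<Rightarrow> mono \<Rightarrow> poly" where
  "sq i a = {b. length b = length a \<and> (\<forall>j<length a. a ! j \<le> b ! j) \<and>
               sum_list b = sum_list a + i \<and>
               odd (\<Prod>j<length a. (a ! j) choose (b ! j - a ! j))}"

text \<open>Degree-d part of A^+ M, for M the A-submodule of P_k spanned by the
  monomial set Ms (closed under the Sq^i): spanned by Sq^i(m), i > 0, m \<in> Ms.\<close>
definition hit :: "mono set \<Rightarrow> nat \<Rightarrow> poly set" where
  "hit Ms d = f2span {sq i m | i m. 0 < i \<and> m \<in> Ms \<and> sum_list m + i = d}"

definition mspan :: "mono set \<Rightarrow> poly set" where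
  "mspan Ms = f2span ((\<lambda>m. {m}) ` Ms)"

text \<open>Weight vectors as functions nat => nat, index i standing for omega_{i+1}.\<close>
definition wt :: "mono \<Rightarrow> nat \<Rightarrow> nat" where
  "wt m i = (\<Sum>j<length m. (m ! j div 2 ^ i) mod 2)"

definition wdeg :: "(nat \<Rightarrow> nat) \<Rightarrow> nat" where
  "wdeg w = (\<Sum>i\<in>{i. w i \<noteq> 0}. 2 ^ i * w i)"

definition wless :: "(nat \<Rightarrow> nat) \<Rightarrow> (nat \<Rightarrow> nat) \<Rightarrow> bool" where
  "wless w v = (\<exists>i. w i < v i \<and> (\<forall>j<i. w j = v j))"

definition wle :: "(nat \<Rightarrow> nat) \<Rightarrow> (nat \<Rightarrow> nat) \<Rightarrow> bool" where
  "wle w v = (w = v \<or> wless w v)"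

definition wv :: "nat list \<Rightarrow> nat \<Rightarrow> nat" where
  "wv l i = (if i < length l then l ! i else 0)"

definition dimQP :: "nat \<Rightarrow> nat \<Rightarrow> nat" where
  "dimQP k d = qdim (mspan (monomsk k d)) (hit {m. length m = k} d)"

definition dimQP0 :: "nat \<Rightarrow> nat \<Rightarrow> nat" where
  "dimQP0 k d = qdim (mspan {m \<in> monomsk k d. \<not> posmono m})
                     (hit {m. length m = k \<and> \<not> posmono m} d)"

definition dimQPplus_w :: "nat \<Rightarrow> (nat \<Rightarrow> nat) \<Rightarrow> nat" where
  "dimQPplus_w k w =
     (let d = wdeg w;
          V = mspan {m \<in> monomsk k d. posmono m \<and> wle (wt m) w};
          Vminus = mspan {m \<in> monomsk k d. posmono m \<and> wless (wt m) w}
      in qdim V (f2span ((hit {m. length m = k \<and> posmono m} d \<inter> V) \<union> Vminus)))"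

end

theory Submission
  imports Defs
begin

text \<open>All spaces are finite, so dimensions can be read off from cardinalities. The A-module P_5 splits
  as P_5^0 plus P_5^+, and filtering the degree 24 part of P_5^+ by weight vectors reduces the
  claim to the vanishing of QP_5^+(w) for the weight vectors w not listed. A monomial of degree 24 in
  five variables has an even first weight, and the listed vectors are exactly those that are at
  least (4,2,2,1), the weight of the minimal spike. Below it the weight starts with 0, with 2, with
  (4,0) or with (4,2,0), and such monomials are hit: since Sq^(deg w) w = w^2, one may write
  u w^2 = u Sq^(deg w)(w) and move the square over to u, which leaves only monomials of smaller
  weight.\<close>

section \<open>Finite vector spaces over the two-element field\<close>

text \<open>The claim is an equality of dimensions, and what is counted is the index of the hit
  elements in the span of the monomials up to a given weight. Passing from below w to w multiplies
  this index by 2^(dim QP_5^+(w)), so the product telescopes from index 1 below (4,2,2,1) up to the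
  index of all hits in P_5^+. Hit monomials have to be produced in P_5 rather than in P_5^+: in m =
  u w^2 the root w, and the partial products on which squares act, may miss variables although every
  exponent of m is positive. The return to P_5^+ is possible because a square never changes which
  exponents vanish. Squares are moved across factors x_c^(2^j) only. On such a factor just Sq^0 and
  Sq^(2^j) are nonzero, so every move has two terms, and a leftover monomial is governed by one
  equation between sums of powers of two. Degree 24 enters through these equations. The leftovers of
  (4,0) have first weight at most 3, and those of (4,2,0) have first weight at most 3 or begin with
  (4,0), so each class rests on the previous ones.\<close>

definition f2sub :: "poly set \<Rightarrow> bool" where
  "f2sub V \<longleftrightarrow> {} \<in> V \<and> (\<forall>p\<in>V. \<forall>q\<in>V. padd p q \<in> V)"

lemma padd_ac: "padd (padd p q) r = padd p (padd q r)" "padd p q = padd q p"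
  "padd p (padd q r) = padd q (padd p r)"
  by (auto simp: padd_def)

lemma mem_padd: "x \<in> padd p q \<longleftrightarrow> (x \<in> p) \<noteq> (x \<in> q)"
  by (auto simp: padd_def)

lemma padd_cancel [simp]: "padd p p = {}" "padd p {} = p" "padd {} p = p"
  "padd p (padd p q) = q"
  by (auto simp: padd_def)

lemma padd_eq_iff: "padd p q = r \<longleftrightarrow> q = padd p r"
  by auto

lemma f2subI:
  "{} \<in> V \<Longrightarrow> (\<And>p q. p \<in> V \<Longrightarrow> q \<in> V \<Longrightarrow> padd p q \<in> V) \<Longrightarrow> f2sub V"
  by (simp add: f2sub_def)

lemma f2sub_zero: "f2sub V \<Longrightarrow> {} \<in> V"
  by (simp add: f2sub_def)

lemma f2sub_add: "f2sub V \<Longrightarrow> p \<in> V \<Longrightarrow> q \<in> V \<Longrightarrow> padd p q \<in> V"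
  by (simp add: f2sub_def)

lemma f2span_base: "p \<in> S \<Longrightarrow> p \<in> f2span S"
  using f2span.add[OF _ f2span.zero, of p S] by simp

lemma f2sub_span: "f2sub (f2span S)"
proof (rule f2subI[OF f2span.zero])
  fix p q assume "p \<in> f2span S" and q: "q \<in> f2span S"
  then show "padd p q \<in> f2span S"
    by (induction rule: f2span.induct) (auto simp: padd_ac(1) intro: f2span.add)
qed

lemma f2span_least:
  assumes "f2sub V" "S \<subseteq> V"
  shows "f2span S \<subseteq> V"
proof
  fix p assume "p \<in> f2span S"
  then show "p \<in> V"
    by (induction rule: f2span.induct) (use assms in \<open>auto intro: f2sub_zero f2sub_add\<close>)
qed

lemma f2span_mono: "S \<subseteq> T \<Longrightarrow> f2span S \<subseteq> f2span T"
  by (meson f2span_base f2span_least f2sub_span subset_iff)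

lemma f2span_sub: "f2sub V \<Longrightarrow> f2span V = V"
  by (meson f2span_base f2span_least subset_antisym subset_refl subsetI)

lemma f2sub_Int: "f2sub A \<Longrightarrow> f2sub B \<Longrightarrow> f2sub (A \<inter> B)"
  by (auto simp: f2sub_def)

lemma f2sub_Pow: "f2sub (Pow M)"
  by (rule f2subI) (auto simp: padd_def)

section \<open>Sums of subspaces, indices and dimensions by counting\<close>

lemma f2span_Un:
  assumes "f2sub A" "f2sub B"
  shows "f2span (A \<union> B) = (\<lambda>(a, b). padd a b) ` (A \<times> B)" (is "_ = ?R")
proof
  have "f2sub ?R"
  proof (rule f2subI)
    show "{} \<in> ?R" using assms by (force dest: f2sub_zero)
    fix p q assume "p \<in> ?R" "q \<in> ?R"
    then obtain a b a' b' where *: "a \<in> A" "b \<in> B" "p = padd a b" "a' \<in> A" "b' \<in> B" "q = padd a' b'"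
      by auto
    have "padd p q = padd (padd a a') (padd b b')" using * by (simp add: padd_ac)
    then show "padd p q \<in> ?R" using * assms by (force intro: f2sub_add)
  qed
  moreover have "A \<union> B \<subseteq> ?R"
  proof
    fix x assume "x \<in> A \<union> B"
    then have "(x, {}) \<in> A \<times> B \<or> ({}, x) \<in> A \<times> B" using assms f2sub_zero by auto
    then show "x \<in> ?R" by force
  qed
  ultimately show "f2span (A \<union> B) \<subseteq> ?R" by (rule f2span_least)
  show "?R \<subseteq> f2span (A \<union> B)"
    using f2sub_add[OF f2sub_span[of "A \<union> B"]] f2span_base[of _ "A \<union> B"] by auto
qed

text \<open>Each nonempty fibre of addition on \<open>A \<times> B\<close> is a copy of
  \<open>A \<inter> B\<close>: an element c of the intersection moves (a, b) to (a + c, b + c)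
  without changing the sum.\<close>

lemma card_f2span_Un:
  assumes "f2sub A" "f2sub B" "finite A" "finite B"
  shows "card (f2span (A \<union> B)) * card (A \<inter> B) = card A * card B"
proof -
  let ?f = "\<lambda>(a, b). padd a b"
  let ?F = "\<lambda>s. {z \<in> A \<times> B. ?f z = s}"
  have fib: "card (?F s) = card (A \<inter> B)" if "s \<in> ?f ` (A \<times> B)" for s
  proof -
    obtain a b where ab: "a \<in> A" "b \<in> B" "s = padd a b" using \<open>s \<in> _\<close> by auto
    have "bij_betw (\<lambda>c. (padd a c, padd b c)) (A \<inter> B) (?F s)"
    proof (rule bij_betw_byWitness[where f' = "\<lambda>(x, y). padd a x"])
      show "\<forall>c\<in>A \<inter> B. (case (padd a c, padd b c) of (x, y) \<Rightarrow> padd a x) = c" by simp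
      show "\<forall>z\<in>?F s. (padd a (case z of (x, y) \<Rightarrow> padd a x), padd b (case z of (x, y) \<Rightarrow> padd a x)) = z"
      proof
        fix z assume z: "z \<in> ?F s"
        obtain x y where xy: "z = (x, y)" by force
        then have "padd x y = s" using z by simp
        then have "y = padd x (padd a b)" using ab by (simp add: padd_eq_iff)
        then have "y = padd b (padd a x)" by (simp add: padd_ac)
        then show "(padd a (case z of (x, y) \<Rightarrow> padd a x), padd b (case z of (x, y) \<Rightarrow> padd a x)) = z"
          by (simp add: xy)
      qed
      show "(\<lambda>c. (padd a c, padd b c)) ` (A \<inter> B) \<subseteq> ?F s"
        using ab assms by (auto intro: f2sub_add simp: padd_ac)
      show "(\<lambda>(x, y). padd a x) ` ?F s \<subseteq> A \<inter> B"
      proof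
        fix t assume "t \<in> (\<lambda>(x, y). padd a x) ` ?F s"
        then obtain x y where *: "x \<in> A" "y \<in> B" "padd x y = s" and t: "t = padd a x" by auto
        then have "padd a x = padd b y" using ab by (metis padd_ac(3) padd_cancel(4) padd_ac(2))
        then show "t \<in> A \<inter> B" using * t ab assms by (metis IntI f2sub_add)
      qed
    qed
    then show ?thesis by (simp add: bij_betw_same_card)
  qed
  have "card A * card B = card (A \<times> B)" by (simp add: card_cartesian_product)
  also have "\<dots> = (\<Sum>s\<in>?f ` (A \<times> B). card (?F s))"
    using sum.image_gen[of "A \<times> B" "\<lambda>_. 1::nat" ?f] assms by simp
  also have "\<dots> = card (?f ` (A \<times> B)) * card (A \<inter> B)"
    using fib by simp
  finally show ?thesis using f2span_Un[OF assms(1,2)] by simp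
qed

lemma f2sub_pair: "f2sub {{}, p}"
  by (rule f2subI) auto

lemma f2span_insert:
  assumes "f2sub W"
  shows "f2span (insert p W) = f2span ({{}, p} \<union> W)"
proof
  show "f2span (insert p W) \<subseteq> f2span ({{}, p} \<union> W)"
    by (rule f2span_mono) auto
  show "f2span ({{}, p} \<union> W) \<subseteq> f2span (insert p W)"
    by (rule f2span_least[OF f2sub_span]) (auto intro: f2span_base f2span.zero)
qed

lemma card_f2span_insert:
  assumes "f2sub W" "finite W" "p \<notin> W"
  shows "card (f2span (insert p W)) = 2 * card W"
proof -
  have "p \<noteq> {}" using assms f2sub_zero by metis
  moreover have "{{}, p} \<inter> W = {{}}" using assms f2sub_zero by auto
  ultimately show ?thesis
    using card_f2span_Un[OF f2sub_pair assms(1) _ assms(2), of p] assms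
    by (simp add: f2span_insert)
qed

lemma f2span_Un_span: "f2span (S \<union> f2span T) = f2span (S \<union> T)"
proof
  show "f2span (S \<union> f2span T) \<subseteq> f2span (S \<union> T)"
    using f2span_mono[of T "S \<union> T"]
    by (intro f2span_least[OF f2sub_span]) (auto intro: f2span_base)
  show "f2span (S \<union> T) \<subseteq> f2span (S \<union> f2span T)"
    by (rule f2span_mono) (auto intro: f2span_base)
qed

lemma f2span_span_Un: "f2span (f2span S \<union> f2span T) = f2span (S \<union> T)"
  by (metis Un_commute f2span_Un_span)

text \<open>\<open>qdim\<close> is a minimum over arbitrary finite generating sets modulo
  \<open>U\<close>, redundant ones included; this bound shows that none of them is smaller than a
  basis.\<close>

lemma card_f2span_le:
  assumes "finite B" "f2sub U" "finite U"
  shows "finite (f2span (B \<union> U)) \<and> card (f2span (B \<union> U)) \<le> 2 ^ card B * card U"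
  using assms(1)
proof (induction B)
  case empty
  then show ?case using assms by (simp add: f2span_sub)
next
  case (insert p B)
  let ?W = "f2span (B \<union> U)"
  have eq: "f2span (insert p B \<union> U) = f2span (insert p ?W)"
    using f2span_Un_span[of "{p}" "B \<union> U"] by (simp add: Un_assoc)
  have fin: "finite (f2span (insert p ?W))"
    using f2span_insert[OF f2sub_span, of p] f2span_Un[OF f2sub_pair f2sub_span] insert
    by simp
  have "card (f2span (insert p ?W)) \<le> 2 * card ?W"
  proof (cases "p \<in> ?W")
    case True
    then have "insert p ?W = ?W" by auto
    then show ?thesis by (simp add: f2span_sub[OF f2sub_span])
  next
    case False
    then show ?thesis using card_f2span_insert[OF f2sub_span] insert by auto
  qed
  also have "\<dots> \<le> 2 ^ card (insert p B) * card U" using insert by simp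
  finally show ?case using fin unfolding eq by simp
qed

text \<open>Greedy extension: adjoining a vector outside \<open>U\<close> doubles
  \<open>card U\<close>, so the gap to \<open>card V\<close> shrinks.\<close>

lemma f2_basis:
  assumes "f2sub V" "finite V"
  shows "f2sub U \<Longrightarrow> U \<subseteq> V \<Longrightarrow>
    \<exists>B. finite B \<and> B \<subseteq> V \<and> f2span (B \<union> U) = V \<and> card V = 2 ^ card B * card U"
proof (induction "card V - card U" arbitrary: U rule: less_induct)
  case less
  show ?case
  proof (cases "U = V")
    case True
    then show ?thesis using less by (intro exI[of _ "{}"]) (simp add: f2span_sub)
  next
    case False
    then obtain p where p: "p \<in> V" "p \<notin> U" using less by auto
    let ?U = "f2span (insert p U)"
    have finU: "finite U" using less(3) assms(2) by (rule finite_subset)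
    have sub: "?U \<subseteq> V" using p less assms by (intro f2span_least) auto
    have c: "card ?U = 2 * card U" using card_f2span_insert p less finU by auto
    have "card U > 0" using finU f2sub_zero less card_gt_0_iff by blast
    moreover have "card ?U \<le> card V" using sub assms card_mono by auto
    ultimately have "card V - card ?U < card V - card U" using c by simp
    from less(1)[OF this f2sub_span sub] obtain B where
      B: "finite B" "B \<subseteq> V" "f2span (B \<union> ?U) = V" "card V = 2 ^ card B * card ?U" by auto
    have V: "f2span (insert p B \<union> U) = V"
      using B f2span_Un_span[of B "insert p U"] by simp
    \<comment> \<open>Squeezing \<open>card V\<close> between two bounds gives the exact power of
      two without first excluding \<open>p \<in> B\<close>.\<close>
    have "card V \<le> 2 ^ card (insert p B) * card U"
      using card_f2span_le[of "insert p B" U] B V less finU by simp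
    moreover have "2 ^ card (insert p B) * card U \<le> 2 ^ Suc (card B) * card U"
      using B by (intro mult_right_mono power_increasing) (auto simp: card_insert_if)
    ultimately have "card V = 2 ^ card (insert p B) * card U"
      unfolding B(4) c by (simp add: mult.assoc mult.left_commute le_antisym)
    then show ?thesis using B p V by (intro exI[of _ "insert p B"]) auto
  qed
qed

lemma card_qdim:
  assumes "f2sub V" "finite V" "f2sub U" "U \<subseteq> V"
  shows "card V = 2 ^ qdim V U * card U"
proof -
  let ?P = "\<lambda>n. \<exists>B. finite B \<and> card B = n \<and> B \<subseteq> V \<and> f2span (B \<union> U) = V"
  have finU: "finite U" using assms(4,2) by (rule finite_subset)
  then have pos: "card U > 0" using f2sub_zero assms card_gt_0_iff by blast
  obtain B where B: "finite B" "B \<subseteq> V" "f2span (B \<union> U) = V" "card V = 2 ^ card B * card U"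
    using f2_basis[OF assms] by auto
  have "card B \<le> n" if "?P n" for n
  proof -
    obtain C where C: "finite C" "card C = n" "f2span (C \<union> U) = V" using \<open>?P n\<close> by auto
    then have "2 ^ card B * card U \<le> 2 ^ n * card U"
      using card_f2span_le[of C U] assms finU B by auto
    then show ?thesis using pos by simp
  qed
  then have "qdim V U = card B"
    unfolding qdim_def using B by (intro Least_equality) auto
  then show ?thesis using B by simp
qed

section \<open>Spaces spanned by monomials\<close>

lemma mspan_eq_Pow:
  assumes "finite M"
  shows "mspan M = Pow M"
proof
  show "mspan M \<subseteq> Pow M"
    unfolding mspan_def by (rule f2span_least[OF f2sub_Pow]) auto
  have "p \<in> mspan M" if "finite p" "p \<subseteq> M" for p
    using that
  proof (induction p)
    case empty
    then show ?case by (simp add: mspan_def f2span.zero)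
  next
    case (insert x p)
    then have "padd {x} p \<in> mspan M"
      unfolding mspan_def by (intro f2span.add) auto
    moreover have "padd {x} p = insert x p" using insert by (auto simp: padd_def)
    ultimately show ?case by simp
  qed
  then show "Pow M \<subseteq> mspan M" using finite_subset[OF _ assms] by auto
qed

lemma f2sub_singletons:
  assumes "f2sub W" "finite M" "\<And>m. m \<in> M \<Longrightarrow> {m} \<in> W"
  shows "Pow M \<subseteq> W"
proof -
  have "(\<lambda>m. {m}) ` M \<subseteq> W" using assms(3) by blast
  then have "mspan M \<subseteq> W" unfolding mspan_def by (rule f2span_least[OF assms(1)])
  then show ?thesis by (simp only: mspan_eq_Pow[OF assms(2)])
qed

section \<open>Steenrod squares of monomials\<close>

lemma mem_sq_iff:
  "b \<in> sq i a \<longleftrightarrow> length b = length a \<and> sum_list b = sum_list a + i \<and>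
     (\<forall>j<length a. a ! j \<le> b ! j \<and> odd ((a ! j) choose (b ! j - a ! j)))"
proof -
  have "even (prod f A) \<longleftrightarrow> (\<exists>j\<in>A. even (f j))" if "finite A" for f :: "nat \<Rightarrow> nat" and A
    using that by (induction A) auto
  then show ?thesis unfolding sq_def by auto
qed

lemma odd_choose_le: "odd (n choose k) \<Longrightarrow> k \<le> n"
  by (metis binomial_eq_0 even_zero not_le)

lemma sum_list_pointwise_eq:
  fixes a b :: "nat list"
  assumes "length a = length b" "\<And>j. j < length a \<Longrightarrow> a ! j \<le> b ! j" "sum_list a = sum_list b"
  shows "a = b"
  using assms
proof (induction a b rule: list_induct2)
  case Nil
  then show ?case by simp
next
  case (Cons x xs y ys)
  have "x \<le> y" using Cons.prems(1)[of 0] by simp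
  moreover have le: "xs ! j \<le> ys ! j" if "j < length xs" for j
    using Cons.prems(1)[of "Suc j"] that by simp
  moreover have "sum_list xs \<le> sum_list ys"
    unfolding sum_list_sum_nth Cons.hyps(1)[symmetric] using le by (intro sum_mono) auto
  ultimately have "x = y" "sum_list xs = sum_list ys" using Cons.prems(2) by auto
  then show ?case using Cons.IH le by simp
qed

lemma sq_0: "sq 0 a = {a}"
proof -
  have "b = a" if "b \<in> sq 0 a" for b
    using that sum_list_pointwise_eq[of a b] by (simp add: mem_sq_iff)
  moreover have "a \<in> sq 0 a" by (simp add: mem_sq_iff)
  ultimately show ?thesis by blast
qed

text \<open>No exponent can grow by more than itself, because the binomial would vanish; a total
  growth of \<open>sum_list a\<close> therefore doubles every exponent. This is Sq^(deg a)(a) =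
  a^2.\<close>

lemma sq_top: "sq (sum_list a) a = {map ((*) 2) a}"
proof -
  have s: "sum_list (map ((*) 2) a) = sum_list a + sum_list a"
    by (induction a) auto
  have "b = map ((*) 2) a" if "b \<in> sq (sum_list a) a" for b
  proof (rule sum_list_pointwise_eq)
    show "length b = length (map ((*) 2) a)" "sum_list b = sum_list (map ((*) 2) a)"
      using that s by (auto simp: mem_sq_iff)
    fix j assume "j < length b"
    then have "b ! j - a ! j \<le> a ! j" "j < length a"
      using that by (auto simp: mem_sq_iff intro: odd_choose_le)
    then show "b ! j \<le> map ((*) 2) a ! j" by simp
  qed
  moreover have "map ((*) 2) a \<in> sq (sum_list a) a" using s by (simp add: mem_sq_iff)
  ultimately show ?thesis by blast
qed

text \<open>Compare coefficients of x^t in (1 + x)^(n + 2^j) = (1 + x)^n (1 + x^(2^j)) modulo 2. In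
  the induction the identity is applied twice and the middle terms cancel.\<close>

lemma odd_choose_add_power2:
  "odd ((n + 2 ^ j) choose t) \<longleftrightarrow> odd (n choose t) \<noteq> (2 ^ j \<le> t \<and> odd (n choose (t - 2 ^ j)))"
proof (induction j arbitrary: n t)
  case 0
  then show ?case by (cases t) auto
next
  case (Suc j)
  have "odd ((n + 2 ^ j + 2 ^ j) choose t) \<longleftrightarrow>
    odd (n choose t) \<noteq> (2 ^ j + 2 ^ j \<le> t \<and> odd (n choose (t - 2 ^ j - 2 ^ j)))"
    unfolding Suc by auto
  then show ?case by (simp add: mult_2 add.assoc)
qed

text \<open>The coefficient of x^m in the total square Sq(x^n) = x^n (1 + x)^n. The guard
  \<open>n \<le> m\<close> matters: truncated subtraction would make the binomial 1 for m <
  n.\<close>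

definition sqc :: "nat \<Rightarrow> nat \<Rightarrow> bool" where
  "sqc n m \<longleftrightarrow> n \<le> m \<and> odd (n choose (m - n))"

lemma sqc_add_power2:
  "sqc (n + 2 ^ j) m \<longleftrightarrow>
     (2 ^ j \<le> m \<and> sqc n (m - 2 ^ j)) \<noteq> (2 ^ Suc j \<le> m \<and> sqc n (m - 2 ^ Suc j))"
proof (cases "n + 2 ^ j \<le> m")
  case True
  have "m - 2 ^ j - n = m - (n + 2 ^ j)" "m - 2 ^ Suc j - n = m - (n + 2 ^ j) - 2 ^ j"
    using True by auto
  moreover have "2 ^ Suc j \<le> m \<and> n \<le> m - 2 ^ Suc j \<longleftrightarrow> 2 ^ j \<le> m - (n + 2 ^ j)"
    using True by auto
  ultimately show ?thesis
    using True odd_choose_add_power2[of n j "m - (n + 2 ^ j)"]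
    unfolding sqc_def by (metis add_leE le_diff_conv2)
next
  case False
  then show ?thesis by (auto simp: sqc_def)
qed

text \<open>Multiplication of a monomial by the power x_c^n, with variables numbered from 0.\<close>

definition shift :: "nat \<Rightarrow> nat \<Rightarrow> mono \<Rightarrow> mono" where
  "shift c n a = a[c := a ! c + n]"

lemma length_shift [simp]: "length (shift c n a) = length a"
  by (simp add: shift_def)

lemma nth_shift: "c < length a \<Longrightarrow> shift c n a ! i = (if i = c then a ! c + n else a ! i)"
  by (simp add: shift_def nth_list_update)

lemma sum_list_shift: "c < length a \<Longrightarrow> sum_list (shift c n a) = sum_list a + n"
  by (simp add: shift_def sum_list_update)

lemma mem_shift_image:
  assumes "c < length b"
  shows "b \<in> shift c n ` X \<longleftrightarrow> n \<le> b ! c \<and> b[c := b ! c - n] \<in> X"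
proof
  assume "b \<in> shift c n ` X"
  then show "n \<le> b ! c \<and> b[c := b ! c - n] \<in> X" using assms by (auto simp: shift_def)
next
  assume *: "n \<le> b ! c \<and> b[c := b ! c - n] \<in> X"
  then have "b = shift c n (b[c := b ! c - n])" using assms by (simp add: shift_def)
  then show "b \<in> shift c n ` X" using * by blast
qed

lemma sum_list_diff_update:
  fixes b :: mono
  assumes "c < length b" "n \<le> b ! c"
  shows "sum_list (b[c := b ! c - n]) + n = sum_list b"
proof -
  have "shift c n (b[c := b ! c - n]) = b" using assms by (simp add: shift_def)
  then show ?thesis using sum_list_shift[of c "b[c := b ! c - n]" n] assms by simp
qed

lemma mem_shift_sq:
  assumes c: "c < length a"
  shows "b \<in> shift c n ` sq i a \<longleftrightarrow> length b = length a \<and> sum_list b = sum_list a + i + n \<and>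
    n \<le> b ! c \<and> sqc (a ! c) (b ! c - n) \<and> (\<forall>k<length a. k \<noteq> c \<longrightarrow> sqc (a ! k) (b ! k))"
    (is "?L \<longleftrightarrow> ?R")
proof (cases "length b = length a \<and> n \<le> b ! c")
  case True
  then have cb: "c < length b" using c by simp
  have "?L \<longleftrightarrow> b[c := b ! c - n] \<in> sq i a" using mem_shift_image[OF cb] True by simp
  also have "\<dots> \<longleftrightarrow> sum_list (b[c := b ! c - n]) = sum_list a + i \<and>
    (\<forall>k<length a. sqc (a ! k) (b[c := b ! c - n] ! k))"
    using True by (simp add: mem_sq_iff sqc_def)
  also have "(\<forall>k<length a. sqc (a ! k) (b[c := b ! c - n] ! k)) \<longleftrightarrow>
    sqc (a ! c) (b ! c - n) \<and> (\<forall>k<length a. k \<noteq> c \<longrightarrow> sqc (a ! k) (b ! k))"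
    using c cb by (metis nth_list_update_eq nth_list_update_neq)
  also have "sum_list (b[c := b ! c - n]) = sum_list a + i \<longleftrightarrow> sum_list b = sum_list a + i + n"
    using sum_list_diff_update[OF cb, of n] True by linarith
  finally show ?thesis using True by simp
next
  case False
  have "\<not> ?L"
  proof
    assume ?L
    then obtain x where "x \<in> sq i a" "b = shift c n x" by blast
    then have "length x = length a" "length b = length a" by (auto simp: mem_sq_iff)
    then show False using False mem_shift_image[of c b] c \<open>?L\<close> by simp
  qed
  then show ?thesis using False by blast
qed

text \<open>Cartan formula for a factor x = x_c^(2^j): since Sq(x) = x + x^2, only two terms
  survive. This is why all factors are taken to be two-powers.\<close>

lemma sq_shift:
  assumes c: "c < length a"
  shows "sq i (shift c (2 ^ j) a) = padd (shift c (2 ^ j) ` sq i a)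
    (if 2 ^ j \<le> i then shift c (2 ^ Suc j) ` sq (i - 2 ^ j) a else {})"
proof (rule set_eqI)
  fix b
  let ?L = "length b = length a" and ?S = "sum_list b = sum_list a + i + 2 ^ j"
  let ?R = "\<forall>k<length a. k \<noteq> c \<longrightarrow> sqc (a ! k) (b ! k)"
  let ?X = "2 ^ j \<le> b ! c \<and> sqc (a ! c) (b ! c - 2 ^ j)"
  let ?Y = "2 ^ Suc j \<le> b ! c \<and> sqc (a ! c) (b ! c - 2 ^ Suc j)"
  have "b \<in> sq i (shift c (2 ^ j) a) \<longleftrightarrow> ?L \<and> ?S \<and>
    (\<forall>k<length a. sqc (shift c (2 ^ j) a ! k) (b ! k))"
    unfolding mem_sq_iff sqc_def length_shift sum_list_shift[OF c] by auto
  also have "(\<forall>k<length a. sqc (shift c (2 ^ j) a ! k) (b ! k)) \<longleftrightarrow>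
    sqc (a ! c + 2 ^ j) (b ! c) \<and> ?R"
  proof -
    have "(\<forall>k<length a. P k) \<longleftrightarrow> P c \<and> (\<forall>k<length a. k \<noteq> c \<longrightarrow> P k)" for P
      using c by auto
    from this[of "\<lambda>k. sqc (shift c (2 ^ j) a ! k) (b ! k)"] show ?thesis
      by (simp add: nth_shift[OF c])
  qed
  also have "sqc (a ! c + 2 ^ j) (b ! c) \<longleftrightarrow> ?X \<noteq> ?Y"
    by (rule sqc_add_power2)
  finally have 1: "b \<in> sq i (shift c (2 ^ j) a) \<longleftrightarrow> ?L \<and> ?S \<and> ?X \<noteq> ?Y \<and> ?R" .
  have 2: "b \<in> shift c (2 ^ j) ` sq i a \<longleftrightarrow> ?L \<and> ?S \<and> ?R \<and> ?X"
    unfolding mem_shift_sq[OF c] by blast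
  \<comment> \<open>By degree, a monomial satisfying the conditions of the second term forces
    \<open>2 ^ j \<le> i\<close>, so the \<open>else\<close> branch loses nothing.\<close>
  have le: "2 ^ j \<le> i" if ?L ?S ?R ?Y
  proof -
    have cb: "c < length b" using c \<open>?L\<close> by simp
    have "sum_list a \<le> sum_list (b[c := b ! c - 2 ^ Suc j])"
      unfolding sum_list_sum_nth length_list_update \<open>?L\<close>
    proof (rule sum_mono)
      fix k assume "k \<in> {0..<length a}"
      then show "a ! k \<le> b[c := b ! c - 2 ^ Suc j] ! k"
        using that cb by (cases "k = c") (auto simp: sqc_def)
    qed
    then show ?thesis using sum_list_diff_update[OF cb, of "2 ^ Suc j"] that by simp
  qed
  have 3: "b \<in> (if 2 ^ j \<le> i then shift c (2 ^ Suc j) ` sq (i - 2 ^ j) a else {})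
    \<longleftrightarrow> ?L \<and> ?S \<and> ?R \<and> ?Y"
  proof (cases "2 ^ j \<le> i")
    case True
    then have "sum_list a + (i - 2 ^ j) + 2 ^ Suc j = sum_list a + i + 2 ^ j" by simp
    then have "b \<in> shift c (2 ^ Suc j) ` sq (i - 2 ^ j) a \<longleftrightarrow> ?L \<and> ?S \<and> ?R \<and> ?Y"
      unfolding mem_shift_sq[OF c] by metis
    then show ?thesis using True by simp
  next
    case False
    then show ?thesis using le by auto
  qed
  have "(l \<and> s \<and> x \<noteq> y \<and> r) \<longleftrightarrow> (l \<and> s \<and> r \<and> x) \<noteq> (l \<and> s \<and> r \<and> y)" for l s r x y
    by blast
  note 4 = this[of ?L ?S ?X ?Y ?R]
  show "b \<in> sq i (shift c (2 ^ j) a) \<longleftrightarrow> b \<in> padd (shift c (2 ^ j) ` sq i a)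
    (if 2 ^ j \<le> i then shift c (2 ^ Suc j) ` sq (i - 2 ^ j) a else {})"
    unfolding mem_padd 1 2 3 by (rule 4)
qed

section \<open>Moving squares across products of two-power factors\<close>

text \<open>A list of pairs (c, j) stands for the product of the factors x_c^(2^j);
  variables may repeat, so squarefree parts and squares of them are treated alike.\<close>

definition mulf :: "(nat \<times> nat) list \<Rightarrow> mono \<Rightarrow> mono" where
  "mulf F a = fold (\<lambda>(c, j). shift c (2 ^ j)) F a"

definition fdeg :: "(nat \<times> nat) list \<Rightarrow> nat" where
  "fdeg F = (\<Sum>(c, j)\<leftarrow>F. 2 ^ j)"

text \<open>The possible results of moving a square onto a product: each factor stays in its
  variable and is squared some number of times.\<close>

definition raise :: "(nat \<times> nat) list \<Rightarrow> (nat \<times> nat) list \<Rightarrow> bool" where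
  "raise = list_all2 (\<lambda>(c, j) (c', j'). c' = c \<and> j \<le> j')"

lemma mulf_simps [simp]: "mulf [] a = a" "mulf ((c, j) # F) a = mulf F (shift c (2 ^ j) a)"
  by (auto simp: mulf_def)

lemma fdeg_simps [simp]: "fdeg [] = 0" "fdeg ((c, j) # F) = 2 ^ j + fdeg F"
  "fdeg (F @ G) = fdeg F + fdeg G"
  by (auto simp: fdeg_def)

lemma length_mulf [simp]: "length (mulf F a) = length a"
  by (induction F arbitrary: a) auto

lemma mulf_append: "mulf (F @ G) a = mulf G (mulf F a)"
  by (simp add: mulf_def)

text \<open>Multiplication by a monomial is injective on monomials, so no two terms merge and images
  respect the sum.\<close>

lemma shift_image_padd: "shift c n ` padd p q = padd (shift c n ` p) (shift c n ` q)"
proof -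
  have "inj (shift c n)"
  proof (rule injI)
    fix a b assume *: "shift c n a = shift c n b"
    then have len: "length a = length b" by (metis length_shift)
    show "a = b"
    proof (cases "c < length a")
      case True
      show ?thesis
      proof (rule nth_equalityI[OF len])
        fix i assume "i < length a"
        have "shift c n a ! i = shift c n b ! i" using * by simp
        then show "a ! i = b ! i" using True len by (auto simp: nth_shift split: if_splits)
      qed
    next
      case False
      then show ?thesis using * len by (simp add: shift_def list_update_beyond)
    qed
  qed
  then show ?thesis by (simp add: padd_def image_Un image_set_diff)
qed

lemma mulf_image_padd: "mulf F ` padd p q = padd (mulf F ` p) (mulf F ` q)"
proof (induction F arbitrary: p q)
  case (Cons f F)
  obtain c j where f: "f = (c, j)" by force
  have "mulf (f # F) ` X = mulf F ` shift c (2 ^ j) ` X" for X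
    by (auto simp: f image_image)
  then show ?case by (simp add: shift_image_padd Cons)
qed auto

text \<open>This replaces the formula u Sq^e(w) = chi(Sq^e)(u) w modulo hit polynomials. The antipode
  is avoided by stripping one factor f off u at a time:
  f Sq^e(w) = Sq^e(f w) + f^2 Sq^(e - deg f)(w).\<close>

lemma mulf_sq_mem:
  assumes W: "f2sub W" and gen: "\<And>i m. 0 < i \<Longrightarrow> length m = k \<Longrightarrow> sum_list m + i = d \<Longrightarrow> sq i m \<in> W"
  shows "\<lbrakk>length w = k; \<forall>(c, j)\<in>set F. c < k; sum_list w + fdeg F + e = d;
     \<And>F'. raise F F' \<Longrightarrow> fdeg F' = fdeg F + e \<Longrightarrow> {mulf F' w} \<in> W\<rbrakk> \<Longrightarrow> mulf F ` sq e w \<in> W"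
\<comment> \<open>Stripping a factor shortens \<open>F\<close> and keeps \<open>e\<close>; squaring
  it keeps the length of \<open>F\<close> and lowers \<open>e\<close>. Hence an outer induction on
  \<open>e\<close> and an inner one on \<open>F\<close>.\<close>
proof (induction e arbitrary: F w rule: less_induct)
  case (less e)
  note outer = less.IH
  show ?case using less.prems
  proof (induction F arbitrary: w)
    case Nil
    show ?case
    proof (cases "e = 0")
      case True
      then show ?thesis using Nil.prems(4)[of "[]"] by (simp add: sq_0 raise_def)
    next
      case False
      then show ?thesis using gen[of e w] Nil.prems by simp
    qed
  next
    case (Cons f G)
    obtain c j where f: "f = (c, j)" by force
    have c: "c < length w" using Cons.prems f by auto
    let ?w = "shift c (2 ^ j) w"
    have A: "mulf G ` sq e ?w \<in> W"
    proof (rule Cons.IH)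
      show "length ?w = k" "\<forall>(c, j)\<in>set G. c < k" "sum_list ?w + fdeg G + e = d"
        using Cons.prems f c by (auto simp: sum_list_shift)
      fix F' assume "raise G F'" "fdeg F' = fdeg G + e"
      then show "{mulf F' ?w} \<in> W"
        using Cons.prems(4)[of "f # F'"] f by (simp add: raise_def)
    qed
    let ?G = "(c, Suc j) # G"
    have B: "mulf ?G ` sq (e - 2 ^ j) w \<in> W" if j: "2 ^ j \<le> e"
    proof (rule outer)
      have "(0::nat) < 2 ^ j" by simp
      then show "e - 2 ^ j < e" using j by linarith
      show "length w = k" "\<forall>(c, j)\<in>set ?G. c < k" "sum_list w + fdeg ?G + (e - 2 ^ j) = d"
        using Cons.prems f j by auto
      fix F' assume F': "raise ?G F'" "fdeg F' = fdeg ?G + (e - 2 ^ j)"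
      have "raise (f # G) F'" using F'(1) f unfolding raise_def by (cases F') auto
      then show "{mulf F' w} \<in> W"
        using Cons.prems(4)[of F'] f j F'(2) by simp
    qed
    have img: "mulf ((c, i) # G) ` X = mulf G ` shift c (2 ^ i) ` X" for i X
      by (auto simp: image_image)
    have "mulf (f # G) ` sq e w = padd (mulf G ` sq e ?w)
      (if 2 ^ j \<le> e then mulf ?G ` sq (e - 2 ^ j) w else {})"
      unfolding sq_shift[OF c] mulf_image_padd f img by (auto simp: padd_ac)
    then show ?case using A B f2sub_add[OF W A] by (auto simp: B)
  qed
qed

section \<open>Hit monomials of small weight in degree 24\<close>

lemma wt_eq_length:
  "wt m t = length (filter (\<lambda>c. odd (m ! c div 2 ^ t)) [0..<length m])"
proof -
  have "(\<Sum>j<n. (g j :: nat) mod 2) = length (filter (\<lambda>c. odd (g c)) [0..<n])" for g n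
    by (induction n) (auto simp: odd_iff_mod_2_eq_one)
  then show ?thesis unfolding wt_def .
qed

lemma wt_le_length: "wt m t \<le> length m"
  unfolding wt_eq_length by (rule order_trans[OF length_filter_le]) simp

lemma even_wt_0: "even (wt m 0) \<longleftrightarrow> even (sum_list m)"
proof -
  have "(\<Sum>j<length m. m ! j mod 2) mod 2 = (\<Sum>j<length m. m ! j) mod 2"
    by (rule mod_sum_eq)
  then show ?thesis
    by (simp add: wt_def sum_list_sum_nth atLeast0LessThan even_iff_mod_2_eq_zero)
qed

lemma sum_list_eq_sum_wt:
  assumes "\<And>x. x \<in> set m \<Longrightarrow> x < 2 ^ T"
  shows "sum_list m = (\<Sum>i<T. 2 ^ i * wt m i)"
proof -
  have bits: "(\<Sum>i<T. 2 ^ i * (x div 2 ^ i mod 2)) = x mod 2 ^ T" for x T :: nat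
  proof (induction T)
    case (Suc T)
    have "x mod 2 ^ Suc T = 2 ^ T * (x div 2 ^ T mod 2) + x mod 2 ^ T"
      unfolding power_Suc2 by (rule mod_mult2_eq)
    then show ?case using Suc by simp
  qed simp
  have "(\<Sum>i<T. 2 ^ i * wt m i) = (\<Sum>j<length m. \<Sum>i<T. 2 ^ i * (m ! j div 2 ^ i mod 2))"
    unfolding wt_def sum_distrib_left by (rule sum.swap)
  also have "\<dots> = (\<Sum>j<length m. m ! j)"
    using assms by (intro sum.cong) (simp_all add: bits)
  finally show ?thesis by (simp add: sum_list_sum_nth atLeast0LessThan)
qed

lemma wt_shift_0: "c < length a \<Longrightarrow> wt (shift c n a) 0 \<le> wt a 0 + n mod 2"
proof -
  assume c: "c < length a"
  have *: "wt b 0 = b ! c mod 2 + (\<Sum>j\<in>{..<length a} - {c}. b ! j mod 2)" if "length b = length a" for b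
    using c that by (simp add: wt_def sum.remove[of "{..<length a}" c])
  have "(a ! c + n) mod 2 \<le> a ! c mod 2 + n mod 2" by presburger
  then show ?thesis using c by (simp add: * nth_shift)
qed

text \<open>A factor x_c^(2^j) with j > 0 preserves parities, so only first powers can create odd
  exponents.\<close>

lemma wt_mulf_0:
  "\<forall>(c, j)\<in>set F. c < length a \<Longrightarrow> wt (mulf F a) 0 \<le> wt a 0 + length (filter (\<lambda>(c, j). j = 0) F)"
proof (induction F arbitrary: a)
  case (Cons f F)
  obtain c j where f: "f = (c, j)" by force
  have "wt (mulf (f # F) a) 0 \<le> wt (shift c (2 ^ j) a) 0 + length (filter (\<lambda>(c, j). j = 0) F)"
    using Cons by (simp add: f)
  moreover have "wt (shift c (2 ^ j) a) 0 \<le> wt a 0 + 2 ^ j mod 2"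
    using Cons.prems by (intro wt_shift_0) (simp add: f)
  ultimately show ?case by (cases "j = 0") (auto simp: f)
qed simp

lemma sum_list_mulf:
  "\<forall>(c, j)\<in>set F. c < length a \<Longrightarrow> sum_list (mulf F a) = sum_list a + fdeg F"
  by (induction F arbitrary: a) (auto simp: sum_list_shift)

lemma dvd_nth_mulf:
  "\<lbrakk>\<forall>(c, j)\<in>set F. c < length a \<and> n dvd 2 ^ j; \<forall>i<length a. n dvd a ! i; i < length a\<rbrakk>
    \<Longrightarrow> n dvd mulf F a ! i"
proof (induction F arbitrary: a)
  case (Cons f F)
  obtain c j where f: "f = (c, j)" by force
  have "\<forall>i<length a. n dvd shift c (2 ^ j) a ! i"
    using Cons.prems by (auto simp: f nth_shift)
  then show ?case using Cons by (simp add: f)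
qed simp

text \<open>The squarefree product over \<open>xs\<close> raised to the power 2^t. For
  \<open>xs = digit_pos t m\<close> it is the part of \<open>m\<close> contributed by the t-th
  binary digits of its exponents.\<close>

definition level :: "nat \<Rightarrow> nat list \<Rightarrow> (nat \<times> nat) list" where
  "level t = map (\<lambda>c. (c, t))"

lemma fdeg_level [simp]: "fdeg (level t xs) = length xs * 2 ^ t"
  by (induction xs) (auto simp: level_def)

lemma nth_mulf_level:
  "\<lbrakk>distinct xs; \<forall>c\<in>set xs. c < length a; i < length a\<rbrakk>
    \<Longrightarrow> mulf (level t xs) a ! i = a ! i + (if i \<in> set xs then 2 ^ t else 0)"
  by (induction xs arbitrary: a) (auto simp: nth_shift level_def)

lemma raise_level:
  "raise (level t xs) F \<Longrightarrow>
    \<exists>js. length js = length xs \<and> F = zip xs js \<and> (\<forall>j\<in>set js. t \<le> j)"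
proof (induction xs arbitrary: F)
  case (Cons x xs)
  then obtain j F' where F: "F = (x, j) # F'" "t \<le> j" "raise (level t xs) F'"
    by (auto simp: raise_def level_def list_all2_Cons1)
  then obtain js where "length js = length xs" "F' = zip xs js" "\<forall>j\<in>set js. t \<le> j"
    using Cons.IH by blast
  then show ?case using F by (intro exI[of _ "j # js"]) simp
qed (simp add: raise_def level_def)

lemma fdeg_zip: "length xs = length js \<Longrightarrow> fdeg (zip xs js) = (\<Sum>j\<leftarrow>js. 2 ^ j)"
  by (induction xs js rule: list_induct2) auto

lemma length_filter_zip_0:
  "length xs = length js \<Longrightarrow>
    length (filter (\<lambda>(c, j). j = 0) (zip xs js)) = length (filter (\<lambda>j. j = (0::nat)) js)"
  by (induction xs js rule: list_induct2) auto

text \<open>To be applied to the raised exponents of u: either nothing was moved onto u, or fewer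
  first-power factors remain.\<close>

lemma zeros_cases:
  obtains "js = replicate (length js) (0::nat)" | "length (filter (\<lambda>j. j = 0) js) < length js"
proof (cases "\<forall>j\<in>set js. j = 0")
  case True
  then show ?thesis using that(1) by (simp add: replicate_length_same)
next
  case False
  then obtain x where "x \<in> set js" "x \<noteq> 0" by blast
  then show ?thesis by (intro that(2) length_filter_less[of x])
qed

definition digit_pos :: "nat \<Rightarrow> mono \<Rightarrow> nat list" where
  "digit_pos t m = filter (\<lambda>c. odd (m ! c div 2 ^ t)) [0..<length m]"

lemma digit_pos_props [simp]: "distinct (digit_pos t m)" "length (digit_pos t m) = wt m t"
  "c \<in> set (digit_pos t m) \<longleftrightarrow> c < length m \<and> odd (m ! c div 2 ^ t)"
  by (auto simp: digit_pos_def wt_eq_length)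

lemma wt_eq_0_iff: "wt m t = 0 \<longleftrightarrow> (\<forall>c<length m. even (m ! c div 2 ^ t))"
  by (auto simp: wt_eq_length filter_empty_conv)

lemma f2sub_hit: "f2sub (hit Ms d)"
  unfolding hit_def by (rule f2sub_span)

lemma sq_hit: "0 < i \<Longrightarrow> m \<in> Ms \<Longrightarrow> sum_list m + i = d \<Longrightarrow> sq i m \<in> hit Ms d"
  unfolding hit_def by (rule f2span_base) auto

lemma level_digit_pos_lt: "\<forall>(c, j)\<in>set (level t (digit_pos s m)). c < length m"
  by (auto simp: level_def)

lemma zip_digit_pos_lt: "\<forall>(c, j)\<in>set (zip (digit_pos s m) js). c < length m"
  by (auto dest!: set_zip_leftD)

text \<open>13 = 8 + 4 + 1 has three binary ones, too many for two powers of two, and 12 splits only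
  as 8 + 4.\<close>

lemma two_powers_sum:
  fixes a b :: nat
  shows "2 ^ a + 2 ^ b \<noteq> (13::nat)" "2 ^ a + 2 ^ b = (12::nat) \<Longrightarrow> 2 \<le> a \<and> 2 \<le> b"
proof -
  have lt: "x < 4" if "2 ^ x < (16::nat)" for x :: nat
    using that power_strict_increasing_iff[of "2::nat" x 4] by simp
  have cs: "x = 0 \<or> x = 1 \<or> x = 2 \<or> x = 3" if "x < 4" for x :: nat
    using that by auto
  have "a < 4 \<and> b < 4" if "2 ^ a + 2 ^ b < (16::nat)"
    using that lt[of a] lt[of b] by linarith
  then have ab: "a \<in> {0, 1, 2, 3} \<and> b \<in> {0, 1, 2, 3}" if "2 ^ a + 2 ^ b < (16::nat)"
    using that cs by auto
  show "2 ^ a + 2 ^ b \<noteq> (13::nat)"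
  proof
    assume "2 ^ a + 2 ^ b = (13::nat)"
    then show False using ab by auto
  qed
  show "2 \<le> a \<and> 2 \<le> b" if "2 ^ a + 2 ^ b = (12::nat)"
    using ab that by auto
qed

lemma degree_mulf_double:
  "\<forall>(c, j)\<in>set F. c < length w \<Longrightarrow> 2 * sum_list w + fdeg F = sum_list (mulf F (map ((*) 2) w))"
  using sum_list_mulf[of F "map ((*) 2) w"] by (simp add: sum_list_const_mult)

text \<open>The case e = deg w of \<open>mulf_sq_mem\<close>, where Sq^e(w) = w^2: the monomial F
  w^2 is hit as soon as all leftovers F' w are.\<close>

lemma mulf_double_hit:
  assumes F: "\<forall>(c, j)\<in>set F. c < length w"
    and m: "mulf F (map ((*) 2) w) = m" "length m = k" "sum_list m = d"
    and mem: "\<And>F'. \<lbrakk>raise F F'; fdeg F' = fdeg F + sum_list w\<rbrakk>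
      \<Longrightarrow> {mulf F' w} \<in> hit {m. length m = k} d"
  shows "{m} \<in> hit {m. length m = k} d"
proof -
  have len: "length w = k" using m by auto
  have deg: "2 * sum_list w + fdeg F = d" using degree_mulf_double[OF F] m by simp
  have "mulf F ` sq (sum_list w) w \<in> hit {m. length m = k} d"
  proof (rule mulf_sq_mem[OF f2sub_hit])
    fix i m assume "0 < i" "length m = k" "sum_list m + i = d"
    then show "sq i m \<in> hit {m. length m = k} d" by (intro sq_hit) auto
  qed (use F len deg mem in auto)
  then show ?thesis by (simp only: sq_top image_insert image_empty m(1))
qed

text \<open>Here deg w is 12 or 11. Moving Sq^(deg w) onto a product of 0 or 2 distinct variables would
  give two-power exponents with sum 12 (no summands) or 13 = 2^a + 2^b, both impossible.\<close>

lemma hit_wt_le_3: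
  assumes len: "length m = k" and s: "sum_list m = 24" and wt: "wt m 0 \<le> 3"
  shows "{m} \<in> hit {m. length m = k} 24"
proof -
  define w where "w = map (\<lambda>x. x div 2) m"
  let ?xs = "digit_pos 0 m"
  let ?F = "level 0 ?xs"
  have lw: "length w = length m" by (simp add: w_def)
  have F: "\<forall>(c, j)\<in>set ?F. c < length w" using level_digit_pos_lt[of 0 0 m] lw by simp
  have m: "mulf ?F (map ((*) 2) w) = m"
    by (rule nth_equalityI) (auto simp: nth_mulf_level w_def)
  have d: "2 * sum_list w + wt m 0 = 24" using degree_mulf_double[OF F] m s by simp
  show ?thesis
  proof (rule mulf_double_hit[OF F m len s])
    fix F' assume "raise ?F F'" and F': "fdeg F' = fdeg ?F + sum_list w"
    then obtain js where js: "length js = wt m 0" "F' = zip ?xs js"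
      using raise_level by fastforce
    have sum: "(\<Sum>j\<leftarrow>js. 2 ^ j) = wt m 0 + sum_list w"
      using F' js by (simp add: fdeg_zip)
    have "even (wt m 0)" using s by (simp add: even_wt_0)
    then consider "wt m 0 = 0" | "wt m 0 = 2" using wt by (fastforce elim!: evenE)
    then have False
    proof cases
      case 1
      then have "sum_list w = 0" using js sum by simp
      then show ?thesis using d 1 by linarith
    next
      case 2
      then obtain a b where "js = [a, b]" using js by (auto simp: numeral_2_eq_2 length_Suc_conv)
      moreover have "sum_list w = 11" using d 2 by simp
      ultimately have "2 ^ a + 2 ^ b = (13::nat)" using sum 2 by simp
      then show ?thesis using two_powers_sum by blast
    qed
    then show "{mulf F' w} \<in> hit {m. length m = k} 24" ..
  qed
qed

text \<open>Since the second weight is 0, m = u w^2 with w itself a square. Moving Sq^10 onto u raises some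
  exponent of u, which lowers the number of odd exponents.\<close>

lemma hit_wt_4_0:
  assumes len: "length m = k" and s: "sum_list m = 24" and wt: "wt m 0 = 4" "wt m 1 = 0"
  shows "{m} \<in> hit {m. length m = k} 24"
proof -
  \<comment> \<open>Digit 1 vanishes in every exponent x, so x minus its parity is 4 (x div 4),
    whose half is taken. All exponents of \<open>w\<close> are even, so \<open>w\<close> adds
    nothing to the first weight.\<close>
  define w where "w = map (\<lambda>x. 2 * (x div 4)) m"
  let ?xs = "digit_pos 0 m"
  let ?F = "level 0 ?xs"
  have lw: "length w = length m" by (simp add: w_def)
  have F: "\<forall>(c, j)\<in>set ?F. c < length w" using level_digit_pos_lt[of 0 0 m] lw by simp
  have m: "mulf ?F (map ((*) 2) w) = m"
  proof (rule nth_equalityI)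
    fix i assume "i < length (mulf ?F (map ((*) 2) w))"
    then have i: "i < length m" by (simp add: lw)
    then have "even (m ! i div 2)" using wt(2) by (simp add: wt_eq_0_iff)
    then have "2 * (2 * (m ! i div 4)) + (if odd (m ! i) then 1 else 0) = m ! i" by presburger
    then show "mulf ?F (map ((*) 2) w) ! i = m ! i"
      using i by (auto simp: nth_mulf_level w_def split: if_splits)
  qed (simp add: lw)
  have d: "2 * sum_list w + 4 = 24" using degree_mulf_double[OF F] m s wt by simp
  show ?thesis
  proof (rule mulf_double_hit[OF F m len s])
    fix F' assume "raise ?F F'" and F': "fdeg F' = fdeg ?F + sum_list w"
    then obtain js where js: "length js = 4" "F' = zip ?xs js"
      using raise_level wt(1) by fastforce
    have lt: "\<forall>(c, j)\<in>set F'. c < length w" using js zip_digit_pos_lt[of 0 m js] lw by simp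
    \<comment> \<open>14 = 4 + 10, the degrees of u and of the square; four unraised factors would
      give only 4.\<close>
    have sum: "(\<Sum>j\<leftarrow>js. 2 ^ j) = (14::nat)"
      using F' js d wt by (simp add: fdeg_zip)
    have z: "length (filter (\<lambda>j. j = 0) js) < 4"
    proof (cases rule: zeros_cases[of js])
      case 1
      then have "js = replicate 4 0" using js(1) by simp
      then show ?thesis using sum by (simp add: sum_list_replicate)
    next
      case 2
      then show ?thesis using js(1) by simp
    qed
    have "wt w 0 = 0" by (simp add: wt_eq_0_iff w_def)
    then have "wt (mulf F' w) 0 \<le> 3"
      using wt_mulf_0[OF lt] z js wt(1) by (simp add: length_filter_zip_0)
    moreover have "sum_list (mulf F' w) = 24"
      using sum_list_mulf[OF lt] F' d wt by simp
    ultimately show "{mulf F' w} \<in> hit {m. length m = k} 24"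
      using len lw by (intro hit_wt_le_3) auto
  qed
qed

text \<open>Now m = u y^2 w^2 with w a fourth power and deg w = 8. Unless an exponent of u is raised, y^2
  turns into a product of two-powers of total degree 12 = 8 + 4, and the second weight vanishes.\<close>

lemma hit_wt_4_2_0:
  assumes len: "length m = k" and s: "sum_list m = 24"
    and wt: "wt m 0 = 4" "wt m 1 = 2" "wt m 2 = 0"
  shows "{m} \<in> hit {m. length m = k} 24"
proof -
  define w where "w = map (\<lambda>x. 4 * (x div 8)) m"
  let ?xs = "digit_pos 0 m" and ?ys = "digit_pos 1 m"
  \<comment> \<open>With y^2 in front, \<open>mulf_append\<close> shows u as multiplied last, onto a
    monomial whose exponents turn out divisible by 4.\<close>
  let ?F = "level 1 ?ys @ level 0 ?xs"
  have lw: "length w = length m" by (simp add: w_def)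
  have F: "\<forall>(c, j)\<in>set ?F. c < length w"
    using level_digit_pos_lt[of 1 1 m] level_digit_pos_lt[of 0 0 m] lw by auto
  have m: "mulf ?F (map ((*) 2) w) = m"
  proof (rule nth_equalityI)
    fix i assume "i < length (mulf ?F (map ((*) 2) w))"
    then have i: "i < length m" by (simp add: lw)
    then have "even (m ! i div 4)" using wt(3) by (simp add: wt_eq_0_iff)
    then have "2 * (4 * (m ! i div 8)) + (if odd (m ! i div 2) then 2 else 0) +
      (if odd (m ! i) then 1 else 0) = m ! i" by presburger
    then show "mulf ?F (map ((*) 2) w) ! i = m ! i"
      using i by (auto simp: nth_mulf_level mulf_append w_def split: if_splits)
  qed (simp add: lw)
  have d: "2 * sum_list w + 8 = 24" using degree_mulf_double[OF F] m s wt by simp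
  show ?thesis
  proof (rule mulf_double_hit[OF F m len s])
    fix F' assume "raise ?F F'" and F': "fdeg F' = fdeg ?F + sum_list w"
    then obtain Y X where YX: "F' = Y @ X" "raise (level 1 ?ys) Y" "raise (level 0 ?xs) X"
      unfolding raise_def list_all2_append1 by blast
    obtain js where js: "length js = 4" "X = zip ?xs js"
      using raise_level[OF YX(3)] wt(1) by auto
    obtain ks where ks: "length ks = 2" "Y = zip ?ys ks" "\<forall>j\<in>set ks. 1 \<le> j"
      using raise_level[OF YX(2)] wt(2) by auto
    have lt: "\<forall>(c, j)\<in>set F'. c < length w" "\<forall>(c, j)\<in>set Y. c < length w"
      using js ks YX zip_digit_pos_lt[of 0 m js] zip_digit_pos_lt[of 1 m ks] lw by auto
    have deg: "sum_list (mulf F' w) = 24"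
      using sum_list_mulf[OF lt(1)] F' d wt by simp
    \<comment> \<open>16 = 4 + 4 + 8: the degrees of y^2 and u, and that of the square.\<close>
    have sum: "(\<Sum>j\<leftarrow>ks. 2 ^ j) + (\<Sum>j\<leftarrow>js. 2 ^ j) = (16::nat)"
      using F' js ks YX(1) d wt by (simp add: fdeg_zip)
    have "filter (\<lambda>j. j = 0) ks = []" using ks(3) by (auto simp: filter_empty_conv)
    moreover have "wt w 0 = 0" by (simp add: wt_eq_0_iff w_def)
    ultimately have wt': "wt (mulf F' w) 0 \<le> length (filter (\<lambda>j. j = 0) js)"
      using wt_mulf_0[OF lt(1)] js ks(1,2) wt YX(1) by (simp add: length_filter_zip_0)
    show "{mulf F' w} \<in> hit {m. length m = k} 24"
    proof (cases rule: zeros_cases[of js])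
      case 1
      then have jsr: "js = replicate 4 0" using js(1) by simp
      have X: "X = level 0 ?xs"
        unfolding js(2) jsr by (simp add: level_def zip_replicate2 wt)
      obtain a b where ab: "ks = [a, b]" using ks(1) by (auto simp: numeral_2_eq_2 length_Suc_conv)
      have "2 ^ a + 2 ^ b = (12::nat)" using sum ab jsr by (simp add: sum_list_replicate)
      then have "2 \<le> a" "2 \<le> b" using two_powers_sum by blast+
      then have "\<forall>j\<in>set ks. (4::nat) dvd 2 ^ j"
        using ab by (auto intro: le_imp_power_dvd[of 2 _ "2::nat", simplified])
      then have "\<forall>(c, j)\<in>set Y. c < length w \<and> (4::nat) dvd 2 ^ j"
        using lt(2) ks(2) by (auto dest: set_zip_rightD)
      then have dvd: "4 dvd mulf Y w ! i" if "i < length m" for i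
        using that by (intro dvd_nth_mulf) (auto simp: w_def)
      have "wt (mulf F' w) 1 = 0"
        unfolding wt_eq_0_iff
      proof (intro allI impI)
        fix c assume "c < length (mulf F' w)"
        then have c: "c < length m" by (simp add: lw)
        then have "mulf F' w ! c = mulf Y w ! c + (if c \<in> set ?xs then 1 else 0)"
          unfolding YX(1) X mulf_append by (subst nth_mulf_level) (auto simp: lw)
        then show "even (mulf F' w ! c div 2 ^ 1)" using dvd[OF c] by (auto elim!: dvdE)
      qed
      moreover have "wt (mulf F' w) 0 \<le> 4"
        using wt' length_filter_le[of "\<lambda>j. j = 0" js] js(1) by linarith
      ultimately show ?thesis
        using hit_wt_4_0[of "mulf F' w" k] hit_wt_le_3[of "mulf F' w" k] deg len lw
        by (cases "wt (mulf F' w) 0 = 4") auto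
    next
      case 2
      then show ?thesis using wt' js(1) deg len lw by (intro hit_wt_le_3) auto
    qed
  qed
qed

section \<open>Splitting by support and filtering by weight\<close>

lemma finite_monomsk: "finite (monomsk k d)"
proof (rule finite_subset)
  show "monomsk k d \<subseteq> {xs. set xs \<subseteq> {..d} \<and> length xs = k}"
    by (auto simp: monomsk_def intro: member_le_sum_list)
  show "finite {xs. set xs \<subseteq> {..d} \<and> length xs = k}"
    by (rule finite_lists_length_eq) simp
qed

text \<open>An exponent grows by at most itself, so zeros stay zero. Hence P^0 and P^+ are both
  closed under the squares.\<close>

lemma sq_support:
  assumes "b \<in> sq i a"
  shows "length b = length a" "sum_list b = sum_list a + i" "posmono b \<longleftrightarrow> posmono a"
proof -
  note * = assms[unfolded mem_sq_iff]
  then show "length b = length a" "sum_list b = sum_list a + i" by auto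
  have "0 < b ! j \<longleftrightarrow> 0 < a ! j" if "j < length a" for j
  proof -
    have "a ! j \<le> b ! j" "b ! j - a ! j \<le> a ! j"
      using * that by (auto intro: odd_choose_le)
    then show ?thesis by linarith
  qed
  then show "posmono b \<longleftrightarrow> posmono a" using * by (auto simp: posmono_def)
qed

text \<open>The set \<open>S\<close> of truth values covers P, P^0 and P^+ at once, as
  \<open>UNIV\<close>, \<open>{False}\<close> and \<open>{True}\<close>.\<close>

lemma hit_subset_Pow:
  assumes "\<And>m. m \<in> Ms \<Longrightarrow> length m = k \<and> (posmono m \<in> S)"
  shows "hit Ms d \<subseteq> Pow {m \<in> monomsk k d. posmono m \<in> S}"
  unfolding hit_def
proof (rule f2span_least[OF f2sub_Pow], clarsimp)
  fix i m b assume "m \<in> Ms" "b \<in> sq i m"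
  then show "b \<in> monomsk k (sum_list m + i) \<and> posmono b \<in> S"
    using sq_support[of b i m] assms by (auto simp: monomsk_def)
qed

lemma card_Pow_split:
  assumes "finite P"
  shows "card (Pow P) = card (Pow {m \<in> P. \<not> Q m}) * card (Pow {m \<in> P. Q m})"
proof -
  have "card P = card {m \<in> P. \<not> Q m} + card {m \<in> P. Q m}"
    using assms by (subst card_Un_disjoint[symmetric]) (auto intro: arg_cong[where f = card])
  then show ?thesis using assms by (simp add: card_Pow power_add)
qed

abbreviation "monos0 k d \<equiv> {m \<in> monomsk k d. \<not> posmono m}"
abbreviation "monosp k d \<equiv> {m \<in> monomsk k d. posmono m}"
abbreviation "hitall k d \<equiv> hit {m. length m = k} d"
abbreviation "hit0 k d \<equiv> hit {m. length m = k \<and> \<not> posmono m} d"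
abbreviation "hitp k d \<equiv> hit {m. length m = k \<and> posmono m} d"

lemma hit_subset:
  "hitall k d \<subseteq> Pow (monomsk k d)" "hit0 k d \<subseteq> Pow (monos0 k d)" "hitp k d \<subseteq> Pow (monosp k d)"
  using hit_subset_Pow[of "{m. length m = k}" k UNIV d]
    hit_subset_Pow[of "{m. length m = k \<and> \<not> posmono m}" k "{False}" d]
    hit_subset_Pow[of "{m. length m = k \<and> posmono m}" k "{True}" d]
  by auto

lemma finite_hit: "finite (hitall k d)" "finite (hit0 k d)" "finite (hitp k d)"
  by (rule finite_subset[OF hit_subset(1)] finite_subset[OF hit_subset(2)]
      finite_subset[OF hit_subset(3)]; simp add: finite_monomsk)+

lemma hit_split: "hitall k d = f2span (hit0 k d \<union> hitp k d)"
proof -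
  have "hitall k d = f2span ({sq i m | i m. 0 < i \<and> (length m = k \<and> \<not> posmono m) \<and> sum_list m + i = d} \<union>
    {sq i m | i m. 0 < i \<and> (length m = k \<and> posmono m) \<and> sum_list m + i = d})"
    unfolding hit_def by (rule arg_cong[of _ _ f2span]) auto
  also have "\<dots> = f2span (hit0 k d \<union> hitp k d)"
    unfolding hit_def by (simp only: f2span_span_Un mem_Collect_eq)
  finally show ?thesis .
qed

lemma card_hit_split: "card (hitall k d) = card (hit0 k d) * card (hitp k d)"
proof -
  have "hit0 k d \<inter> hitp k d \<subseteq> {{}}" using hit_subset(2,3)[of k d] by blast
  then have "hit0 k d \<inter> hitp k d = {{}}" using f2sub_zero[OF f2sub_hit] by blast
  then show ?thesis
    using card_f2span_Un[OF f2sub_hit f2sub_hit finite_hit(2,3), of k d k d] by (simp add: hit_split)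
qed

text \<open>The P^0-component of a hit polynomial in P^+ is supported on both kinds of monomials,
  hence zero. This brings the hits found in P_k back to P_k^+.\<close>

lemma hitall_pos:
  assumes "p \<in> hitall k d" "p \<subseteq> monosp k d"
  shows "p \<in> hitp k d"
proof -
  obtain a b where ab: "a \<in> hit0 k d" "b \<in> hitp k d" "p = padd a b"
    using assms(1) unfolding hit_split f2span_Un[OF f2sub_hit f2sub_hit] by auto
  then have a: "a = padd p b" by (simp add: padd_ac)
  have "b \<subseteq> monosp k d" and a0: "a \<subseteq> monos0 k d" using ab hit_subset(2,3)[of k d] by blast+
  then have "a \<subseteq> monosp k d" unfolding a padd_def using assms(2) by blast
  then have "a = {}" using a0 by blast
  then show ?thesis using ab by simp
qed

section \<open>Indices of the hit spaces and of the weight filtration\<close>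

lemma card_dimQP: "card (Pow (monomsk k d)) = 2 ^ dimQP k d * card (hitall k d)"
  unfolding dimQP_def mspan_eq_Pow[OF finite_monomsk]
  by (rule card_qdim) (auto simp: f2sub_Pow finite_monomsk f2sub_hit hit_subset)

lemma card_dimQP0: "card (Pow (monos0 k d)) = 2 ^ dimQP0 k d * card (hit0 k d)"
proof -
  have fin: "finite (monos0 k d)" by (simp add: finite_monomsk)
  show ?thesis
    unfolding dimQP0_def mspan_eq_Pow[OF fin]
    by (rule card_qdim) (use fin in \<open>auto simp: f2sub_Pow f2sub_hit hit_subset simp del: Pow_iff\<close>)
qed

abbreviation "pos_le k w \<equiv> {m \<in> monomsk k (wdeg w). posmono m \<and> wle (wt m) w}"
abbreviation "pos_less k w \<equiv> {m \<in> monomsk k (wdeg w). posmono m \<and> wless (wt m) w}"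

text \<open>With V and M the spans up to and below w and H the hits, 2^(dim) is the index of H
  \<inter> V in V divided by that of H \<inter> M in M. The equation is multiplied out to stay in
  the natural numbers.\<close>

lemma card_dimQPplus_w:
  "2 ^ dimQPplus_w k w * card (hitp k (wdeg w) \<inter> Pow (pos_le k w)) * card (Pow (pos_less k w)) =
    card (Pow (pos_le k w)) * card (hitp k (wdeg w) \<inter> Pow (pos_less k w))"
proof -
  let ?V = "Pow (pos_le k w)" and ?M = "Pow (pos_less k w)" and ?H = "hitp k (wdeg w)"
  have fin: "finite (pos_le k w)" "finite (pos_less k w)" by (simp_all add: finite_monomsk)
  have sub: "?M \<subseteq> ?V" by (auto simp: wle_def)
  let ?U = "f2span ((?H \<inter> ?V) \<union> ?M)"
  have HV: "f2sub (?H \<inter> ?V)" by (intro f2sub_Int f2sub_hit f2sub_Pow)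
  have "?U \<subseteq> ?V" using sub by (intro f2span_least f2sub_Pow) auto
  then have "card ?V = 2 ^ dimQPplus_w k w * card ?U"
    unfolding dimQPplus_w_def Let_def mspan_eq_Pow[OF fin(1)] mspan_eq_Pow[OF fin(2)]
    by (intro card_qdim f2sub_Pow f2sub_span) (simp_all add: fin)
  moreover have "card ?U * card ((?H \<inter> ?V) \<inter> ?M) = card (?H \<inter> ?V) * card ?M"
    by (rule card_f2span_Un[OF HV f2sub_Pow]) (simp_all add: fin finite_Int)
  moreover have "(?H \<inter> ?V) \<inter> ?M = ?H \<inter> ?M" using sub by blast
  ultimately show ?thesis by (simp add: mult.assoc)
qed

text \<open>Here \<open>v\<close>, \<open>h\<close> belong to the span below w and
  \<open>v'\<close>, \<open>h'\<close> to the span up to w: an index 2^s becomes 2^(q + s).\<close>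

lemma filtration_step:
  fixes v h v' h' :: nat
  assumes "2 ^ q * h' * v = v' * h" "v = 2 ^ s * h" "0 < h"
  shows "v' = 2 ^ (q + s) * h'"
proof -
  have "v' * h = 2 ^ q * h' * v" using assms(1) by simp
  also have "\<dots> = (2 ^ (q + s) * h') * h" unfolding assms(2) by (simp add: power_add mult_ac)
  finally have "v' * h = (2 ^ (q + s) * h') * h" .
  then show ?thesis using assms(3) by (simp only: mult_cancel2) simp
qed

section \<open>Weight vectors occurring in degree 24\<close>

lemma wdeg_wv: "wdeg (wv l) = (\<Sum>i<length l. 2 ^ i * l ! i)"
  unfolding wdeg_def by (rule sum.mono_neutral_cong_left) (auto simp: wv_def split: if_splits)

lemma all_less_5: "(\<forall>i<5. P i) \<longleftrightarrow> P 0 \<and> P 1 \<and> P 2 \<and> P 3 \<and> P (4::nat)"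
  by (auto simp: eval_nat_numeral less_Suc_eq)

lemma ex_less_5: "(\<exists>i<5. P i) \<longleftrightarrow> P 0 \<or> P 1 \<or> P 2 \<or> P 3 \<or> P (4::nat)"
  using all_less_5[of "\<lambda>i. \<not> P i"] by blast

text \<open>The five positions are binary digits, enough because 24 < 2^5; they are not the five
  variables.\<close>

lemma weight_eq_5:
  assumes "\<And>i. 5 \<le> i \<Longrightarrow> w i = v i"
  shows "w = v \<longleftrightarrow> w 0 = v 0 \<and> w 1 = v 1 \<and> w 2 = v 2 \<and> w 3 = v 3 \<and> w (4::nat) = v 4"
  using all_less_5[of "\<lambda>i. w i = v i"] assms by (metis ext not_le)

lemma wless_5:
  assumes "\<And>i. 5 \<le> i \<Longrightarrow> w i = v i"
  shows "wless w v \<longleftrightarrow> w 0 < v 0 \<or> w 0 = v 0 \<and> (w 1 < v 1 \<or> w 1 = v 1 \<and> (w 2 < v 2 \<or>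
    w 2 = v 2 \<and> (w 3 < v 3 \<or> w 3 = v 3 \<and> w 4 < v 4)))"
proof -
  have "wless w v \<longleftrightarrow> (\<exists>i<5. w i < v i \<and> (\<forall>j<i. w j = v j))"
    unfolding wless_def using assms by (metis less_irrefl not_le)
  also have "\<dots> \<longleftrightarrow> w 0 < v 0 \<or> w 0 = v 0 \<and> (w 1 < v 1 \<or> w 1 = v 1 \<and> (w 2 < v 2 \<or>
    w 2 = v 2 \<and> (w 3 < v 3 \<or> w 3 = v 3 \<and> w 4 < v 4)))"
    unfolding ex_less_5 by (auto simp: eval_nat_numeral less_Suc_eq)
  finally show ?thesis .
qed

lemma wt_degree_24:
  assumes "m \<in> monomsk 5 24"
  shows "wt m 0 + 2 * wt m 1 + 4 * wt m 2 + 8 * wt m 3 + 16 * wt m 4 = 24"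
    and "wt m i \<le> 5" and "5 \<le> i \<Longrightarrow> wt m i = 0"
proof -
  have m: "length m = 5" "sum_list m = 24" using assms by (auto simp: monomsk_def)
  have le: "x \<le> 24" if "x \<in> set m" for x using member_le_sum_list[OF that] m by simp
  then have "sum_list m = (\<Sum>i<5. 2 ^ i * wt m i)"
    by (intro sum_list_eq_sum_wt) force
  then show "wt m 0 + 2 * wt m 1 + 4 * wt m 2 + 8 * wt m 3 + 16 * wt m 4 = 24"
    using m by (simp add: eval_nat_numeral)
  show "wt m i \<le> 5" using wt_le_length[of m i] m by simp
  assume i: "5 \<le> i"
  have "(2::nat) ^ 5 \<le> 2 ^ i" using i by (rule power_increasing) simp
  then have "x div 2 ^ i = 0" if "x \<in> set m" for x using le[OF that] by simp
  then show "wt m i = 0" by (simp add: wt_def)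
qed

text \<open>Parity fixes one entry at a time: the first is even and at most 5; after removing 4 and
  halving, so is the second. Prefixes (4,0) and (4,2,0) are not refined, since they alone make a
  monomial hit.\<close>

lemma wt_degree_24_cases:
  assumes "m \<in> monomsk 5 24"
  defines "w \<equiv> wt m"
  shows "w 0 \<le> 2 \<or> w 0 = 4 \<and>
    (w 1 = 4 \<and> w 2 = 3 \<and> w 3 = 0 \<and> w 4 = 0 \<or> w 1 = 4 \<and> w 2 = 1 \<and> w 3 = 1 \<and> w 4 = 0 \<or>
     w 1 = 2 \<and> w 2 = 4 \<and> w 3 = 0 \<and> w 4 = 0 \<or> w 1 = 2 \<and> w 2 = 2 \<and> w 3 = 1 \<and> w 4 = 0 \<or>
     w 1 = 2 \<and> w 2 = 0 \<or> w 1 = 0)"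
proof -
  have arith: "a \<le> 2 \<or> a = 4 \<and>
    (b = 4 \<and> c = 3 \<and> d = 0 \<and> e = 0 \<or> b = 4 \<and> c = 1 \<and> d = 1 \<and> e = 0 \<or>
     b = 2 \<and> c = 4 \<and> d = 0 \<and> e = 0 \<or> b = 2 \<and> c = 2 \<and> d = 1 \<and> e = 0 \<or> b = 2 \<and> c = 0 \<or> b = 0)"
    if s: "a + 2 * b + 4 * c + 8 * d + 16 * e = 24" and le: "a \<le> 5" "b \<le> 5" "c \<le> 5"
    for a b c d e :: nat
  proof (cases "a \<le> 2")
    case False
    have "even a" using s by presburger
    then have a: "a = 4" using le False by presburger
    then have s: "b + 2 * c + 4 * d + 8 * e = 10" using s by simp
    then have "even b" by presburger
    then have b: "b = 0 \<or> b = 2 \<or> b = 4" using le by presburger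
    from b show ?thesis
    proof (elim disjE)
      assume b: "b = 2"
      then have "c + 2 * d + 4 * e = 4" using s by simp
      then have "c = 4 \<and> d = 0 \<and> e = 0 \<or> c = 2 \<and> d = 1 \<and> e = 0 \<or> c = 0" by presburger
      then show ?thesis using a b by simp
    next
      assume b: "b = 4"
      then have "c + 2 * d + 4 * e = 3" using s by simp
      then have "c = 3 \<and> d = 0 \<and> e = 0 \<or> c = 1 \<and> d = 1 \<and> e = 0" by presburger
      then show ?thesis using a b by simp
    qed (simp add: a)
  qed simp
  show ?thesis
    unfolding w_def using assms(1) by (intro arith wt_degree_24)
qed

text \<open>Among the weights that occur, (4,4,3) > (4,4,1,1) > (4,2,4) > (4,2,2,1) are the four
  largest and adjacent, so lying strictly below one means lying at or below the next.\<close>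

lemma weights_degree_24:
  assumes m: "m \<in> monomsk 5 24"
  shows "wle (wt m) (wv [4, 4, 3])"
    and "wless (wt m) (wv [4, 4, 3]) \<longleftrightarrow> wle (wt m) (wv [4, 4, 1, 1])"
    and "wless (wt m) (wv [4, 4, 1, 1]) \<longleftrightarrow> wle (wt m) (wv [4, 2, 4])"
    and "wless (wt m) (wv [4, 2, 4]) \<longleftrightarrow> wle (wt m) (wv [4, 2, 2, 1])"
    and "wless (wt m) (wv [4, 2, 2, 1]) \<Longrightarrow>
      wt m 0 \<le> 3 \<or> wt m 0 = 4 \<and> wt m 1 = 0 \<or> wt m 0 = 4 \<and> wt m 1 = 2 \<and> wt m 2 = 0"
proof -
  have agree: "5 \<le> i \<Longrightarrow> wt m i = wv l i" if "length l \<le> 4" for l i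
    using wt_degree_24(3)[OF m] that by (simp add: wv_def)
  note iffs = wle_def weight_eq_5[OF agree] wless_5[OF agree] wv_def
  note cases = wt_degree_24_cases[OF m]
  show "wle (wt m) (wv [4, 4, 3])"
    "wless (wt m) (wv [4, 4, 3]) \<longleftrightarrow> wle (wt m) (wv [4, 4, 1, 1])"
    "wless (wt m) (wv [4, 4, 1, 1]) \<longleftrightarrow> wle (wt m) (wv [4, 2, 4])"
    "wless (wt m) (wv [4, 2, 4]) \<longleftrightarrow> wle (wt m) (wv [4, 2, 2, 1])"
    "wless (wt m) (wv [4, 2, 2, 1]) \<Longrightarrow>
      wt m 0 \<le> 3 \<or> wt m 0 = 4 \<and> wt m 1 = 0 \<or> wt m 0 = 4 \<and> wt m 1 = 2 \<and> wt m 2 = 0"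
    using cases by (elim disjE conjE; simp add: iffs)+
qed

theorem theorem3p2:
  shows "dimQP 5 24 = dimQP0 5 24
           + dimQPplus_w 5 (wv [4,4,3]) + dimQPplus_w 5 (wv [4,4,1,1])
           + dimQPplus_w 5 (wv [4,2,2,1]) + dimQPplus_w 5 (wv [4,2,4])"
proof -
  let ?H = "hitp 5 24"
  let ?le = "\<lambda>l. {m \<in> monomsk 5 24. posmono m \<and> wle (wt m) (wv l)}"
  let ?N = "{m \<in> monomsk 5 24. posmono m \<and> wless (wt m) (wv [4, 2, 2, 1])}"
  have deg: "wdeg (wv [4,4,3]) = 24" "wdeg (wv [4,4,1,1]) = 24"
    "wdeg (wv [4,2,2,1]) = 24" "wdeg (wv [4,2,4]) = 24"
    by (simp_all add: wdeg_wv eval_nat_numeral)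
  have less: "{m \<in> monomsk 5 24. posmono m \<and> wless (wt m) (wv [4,4,3])} = ?le [4,4,1,1]"
    "{m \<in> monomsk 5 24. posmono m \<and> wless (wt m) (wv [4,4,1,1])} = ?le [4,2,4]"
    "{m \<in> monomsk 5 24. posmono m \<and> wless (wt m) (wv [4,2,4])} = ?le [4,2,2,1]"
    using weights_degree_24 by blast+
  have top: "?le [4,4,3] = monosp 5 24" using weights_degree_24(1) by blast
  have hit_pos: "0 < card (?H \<inter> Pow M)" for M
    unfolding card_gt_0_iff using f2sub_zero[OF f2sub_hit] finite_hit(3) by blast
  have "{m} \<in> ?H" if "m \<in> ?N" for m
  proof (rule hitall_pos)
    have "length m = 5" "sum_list m = 24" using that by (auto simp: monomsk_def)
    then show "{m} \<in> hitall 5 24"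
      using that weights_degree_24(5)[of m] hit_wt_le_3 hit_wt_4_0 hit_wt_4_2_0 by blast
    show "{m} \<subseteq> monosp 5 24" using that by blast
  qed
  then have "Pow ?N \<subseteq> ?H"
    by (intro f2sub_singletons f2sub_hit) (simp_all add: finite_monomsk)
  then have "?H \<inter> Pow ?N = Pow ?N" by blast
  \<comment> \<open>The telescoping starts here: below the minimal spike every positive monomial is
    hit, so the index is 1.\<close>
  then have 0: "card (Pow ?N) = 2 ^ 0 * card (?H \<inter> Pow ?N)" by simp
  let ?q = "\<lambda>l. dimQPplus_w 5 (wv l)"
  note q = card_dimQPplus_w[of 5 "wv [4,4,3]"] card_dimQPplus_w[of 5 "wv [4,4,1,1]"]
    card_dimQPplus_w[of 5 "wv [4,2,4]"] card_dimQPplus_w[of 5 "wv [4,2,2,1]"]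
  note q = q[unfolded deg less]
  \<comment> \<open>Climbing upwards in the lexicographic order, where (4,2,4) comes after
    (4,2,2,1).\<close>
  note 1 = filtration_step[OF q(4) 0 hit_pos]
  note 2 = filtration_step[OF q(3) 1 hit_pos]
  note 3 = filtration_step[OF q(2) 2 hit_pos]
  note 4 = filtration_step[OF q(1) 3 hit_pos]
  have "?H \<inter> Pow (?le [4,4,3]) = ?H" using hit_subset(3)[of 5 24] unfolding top by blast
  then have pos: "card (Pow (monosp 5 24)) =
    2 ^ (?q [4,4,3] + ?q [4,4,1,1] + ?q [4,2,2,1] + ?q [4,2,4]) * card ?H"
    using 4 by (simp add: top add_ac)
  have "2 ^ dimQP 5 24 * card (hitall 5 24) = card (Pow (monomsk 5 24))"
    by (simp add: card_dimQP)
  also have "\<dots> = card (Pow (monos0 5 24)) * card (Pow (monosp 5 24))"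
    by (rule card_Pow_split[OF finite_monomsk])
  also have "\<dots> = 2 ^ (dimQP0 5 24 + ?q [4,4,3] + ?q [4,4,1,1] + ?q [4,2,2,1] + ?q [4,2,4]) *
    card (hitall 5 24)"
    unfolding pos card_dimQP0 card_hit_split power_add by (simp only: mult_ac)
  finally have *: "2 ^ dimQP 5 24 * card (hitall 5 24) =
    2 ^ (dimQP0 5 24 + ?q [4,4,3] + ?q [4,4,1,1] + ?q [4,2,2,1] + ?q [4,2,4]) * card (hitall 5 24)" .
  have "card (hitall 5 24) \<noteq> 0"
    using f2sub_zero[OF f2sub_hit] finite_hit(1)[of 5 24] unfolding card_eq_0_iff by blast
  then show ?thesis using * by (simp only: mult_cancel2 power_inject_exp) simp
qed

end
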